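(* Suppose there exist $\zeta>0$ and a policy $\pi\in\Pi_\Theta$ such that $V_c^\pi(\rho)-b\ge\zeta$. Let $(\lambda^*,\pi_{\theta^*})$ be an optimal solution of $$\min_{\lambda\ge0}\ \max_{\theta\in\Theta}\ V_r^{\pi_\theta}(\rho)+\lambda\left(V_c^{\pi_\theta}(\rho)-b\right).$$ Then $\lambda^*\in\left[0,\frac{2}{\zeta(1-\gamma)}\right]$.
   Context: $\mathcal S,\mathcal A$ are finite state and action spaces, $\gamma\in[0,1)$, $r,c:\mathcal S\times\mathcal A\to[0,1]$ are the reward and utility functions, $b>0$ is a threshold, $\rho\in\Delta_{\mathcal S}$ is the initial state distribution ($\Delta_X$ is the probability simplex on $X$), and $\mathcal P=\bigotimes_{s,a}\mathcal P_s^a$ with $\mathcal P_s^a\subseteq\Delta_{\mathcal S}$ is an $(s,a)$-rectangular uncertainty set of transition kernels. $\Pi_\Theta=\{\pi_\theta:\theta\in\Theta\}$, $\Theta\subseteq\mathbb R^d$, is a parameterized class of stationary policies $\pi_\theta:\mathcal S\to\Delta_{\mathcal A}$. For $h\in\{r,c\}$ the robust value function is $V_h^\pi(s)=\min_{\kappa\in\bigotimes_{t\ge0}\mathcal P}\mathbb E_\kappa\left[\sum_{t=0}^\infty\gamma^t h(S_t,A_t)\mid S_0=s,\pi\right]$, where $\kappa=(\mathsf P_0,\mathsf P_1,\dots)$, $\mathsf P_t\in\mathcal P$ being the transition kernel at time $t$; and $V_h^\pi(\rho)=\sum_s\rho(s)V_h^\pi(s)$. That $(\lambda^*,\pi_{\theta^*})$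 is an optimal solution means that $\lambda^*\ge 0$ minimizes $\lambda\mapsto\max_{\theta\in\Theta}[V_r^{\pi_\theta}(\rho)+\lambda(V_c^{\pi_\theta}(\rho)-b)]$ over $\lambda\ge0$ and $\theta^*$ attains the inner maximum at $\lambda=\lambda^*$. *)

theory Defs
  imports "HOL-Probability.Probability"
begin

text \<open>For a finite type \<open>'x\<close>, the type \<open>'x pmf\<close> is the probability simplex on \<open>'x\<close>.\<close>

type_synonym ('s, 'a) policy = "'s \<Rightarrow> 'a pmf"
type_synonym ('s, 'a) kernel = "'s \<Rightarrow> 'a \<Rightarrow> 's pmf"

definition rectangular :: "('s \<Rightarrow> 'a \<Rightarrow> 's pmf set) \<Rightarrow> ('s, 'a) kernel set" where
  "rectangular U = {P. \<forall>s a. P s a \<in> U s a}"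

text \<open>
  Conditional law of \<open>(S\<^sub>t, A\<^sub>t)\<close> given the history \<open>\<omega> 0, \<dots>, \<omega> (t - 1)\<close> of state-action
  pairs, when the process starts in \<open>s\<close>; the kernel \<open>\<kappa> t\<close> governs the transition from time
  \<open>t\<close> to time \<open>t + 1\<close>.
\<close>

primrec step_pmf ::
  "(nat \<Rightarrow> ('s, 'a) kernel) \<Rightarrow> ('s, 'a) policy \<Rightarrow> 's \<Rightarrow> nat \<Rightarrow> (nat \<Rightarrow> 's \<times> 'a) \<Rightarrow> ('s \<times> 'a) pmf"
where
  "step_pmf \<kappa> \<pi> s 0 \<omega> = map_pmf (Pair s) (\<pi> s)"
| "step_pmf \<kappa> \<pi> s (Suc t) \<omega> =
     bind_pmf (\<kappa> t (fst (\<omega> t)) (snd (\<omega> t))) (\<lambda>s'. map_pmf (Pair s') (\<pi> s'))"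

lemma Ionescu_Tulcea_step_pmf:
  fixes \<kappa> :: "nat \<Rightarrow> ('s::finite, 'a::finite) kernel"
  shows "Ionescu_Tulcea (\<lambda>t \<omega>. measure_pmf (step_pmf \<kappa> \<pi> s t \<omega>)) (\<lambda>_. count_space UNIV)"
proof
  fix t :: nat
  let ?N = "\<lambda>_::nat. count_space (UNIV :: ('s \<times> 'a) set)"
  show "(\<lambda>\<omega>. measure_pmf (step_pmf \<kappa> \<pi> s t \<omega>))
      \<in> PiM {0..<t} ?N \<rightarrow>\<^sub>M subprob_algebra (count_space UNIV)"
  proof (cases t)
    case 0
    then show ?thesis by (simp add: measure_pmf_in_subprob_algebra)
  next
    case (Suc n)
    have 1: "(\<lambda>\<omega>. \<omega> n) \<in> PiM {0..<t} ?N \<rightarrow>\<^sub>M count_space UNIV"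
      using measurable_component_singleton[of n "{0..<t}" ?N] Suc by simp
    have 2: "(\<lambda>x. measure_pmf (bind_pmf (\<kappa> n (fst x) (snd x)) (\<lambda>s'. map_pmf (Pair s') (\<pi> s'))))
        \<in> count_space (UNIV :: ('s \<times> 'a) set) \<rightarrow>\<^sub>M subprob_algebra (count_space UNIV)"
      by (simp add: measure_pmf_in_subprob_algebra)
    show ?thesis using measurable_compose[OF 1 2] Suc by simp
  qed
qed

text \<open>
  Law of the trajectory \<open>(S\<^sub>0, A\<^sub>0), (S\<^sub>1, A\<^sub>1), \<dots>\<close>, obtained by the Ionescu-Tulcea
  extension theorem.
\<close>

definition trajectory ::
  "(nat \<Rightarrow> ('s::finite, 'a::finite) kernel) \<Rightarrow> ('s, 'a) policy \<Rightarrow> 's \<Rightarrow> (nat \<Rightarrow> 's \<times> 'a) measure"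
where
  "trajectory \<kappa> \<pi> s = projective_family.lim UNIV
     (Ionescu_Tulcea.CI (\<lambda>t \<omega>. measure_pmf (step_pmf \<kappa> \<pi> s t \<omega>)) (\<lambda>_. count_space UNIV))
     (\<lambda>_. count_space UNIV)"

lemma sets_trajectory: "sets (trajectory \<kappa> \<pi> s) = sets (PiM UNIV (\<lambda>_. count_space UNIV))"
proof -
  interpret Ionescu_Tulcea "\<lambda>t \<omega>. measure_pmf (step_pmf \<kappa> \<pi> s t \<omega>)" "\<lambda>_. count_space UNIV"
    by (rule Ionescu_Tulcea_step_pmf)
  show ?thesis unfolding trajectory_def by (rule PF.sets_lim)
qed

lemma prob_space_trajectory: "prob_space (trajectory \<kappa> \<pi> s)"
proof -
  interpret Ionescu_Tulcea "\<lambda>t \<omega>. measure_pmf (step_pmf \<kappa> \<pi> s t \<omega>)" "\<lambda>_. count_space UNIV"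
    by (rule Ionescu_Tulcea_step_pmf)
  have "distr PF.lim (PiM {} (\<lambda>_. count_space UNIV)) (\<lambda>x. restrict x {}) = CI {}"
    by (rule distr_lim) simp
  moreover have "prob_space (CI {})"
    by (rule PF.prob_space_P) simp_all
  moreover have "(\<lambda>x. restrict x {}) \<in> PF.lim \<rightarrow>\<^sub>M PiM {} (\<lambda>_. count_space UNIV)"
    by (auto intro!: measurable_restrict)
  ultimately show ?thesis
    unfolding trajectory_def by (metis prob_space_distrD)
qed

definition discounted_return :: "real \<Rightarrow> ('s \<Rightarrow> 'a \<Rightarrow> real) \<Rightarrow> (nat \<Rightarrow> 's \<times> 'a) \<Rightarrow> real" where
  "discounted_return \<gamma> h \<omega> = (\<Sum>t. \<gamma> ^ t * h (fst (\<omega> t)) (snd (\<omega> t)))"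

text \<open>
  The minimum over all sequences of kernels is rendered as an infimum, which agrees with the
  minimum whenever the latter is attained.
\<close>

definition robust_value ::
  "real \<Rightarrow> ('s::finite \<Rightarrow> 'a::finite \<Rightarrow> 's pmf set) \<Rightarrow> ('s \<Rightarrow> 'a \<Rightarrow> real) \<Rightarrow> ('s, 'a) policy \<Rightarrow> 's \<Rightarrow> real"
where
  "robust_value \<gamma> U h \<pi> s =
     (INF \<kappa>\<in>{\<kappa>. \<forall>t. \<kappa> t \<in> rectangular U}.
        integral\<^sup>L (trajectory \<kappa> \<pi> s) (discounted_return \<gamma> h))"

definition robust_value_init ::
  "real \<Rightarrow> ('s::finite \<Rightarrow> 'a::finite \<Rightarrow> 's pmf set) \<Rightarrow> ('s \<Rightarrow> 'a \<Rightarrow> real) \<Rightarrow> ('s, 'a) policy \<Rightarrow> 's pmf \<Rightarrow> real"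
where
  "robust_value_init \<gamma> U h \<pi> \<rho> = (\<Sum>s\<in>UNIV. pmf \<rho> s * robust_value \<gamma> U h \<pi> s)"

definition lagrangian ::
  "real \<Rightarrow> ('s::finite \<Rightarrow> 'a::finite \<Rightarrow> 's pmf set) \<Rightarrow> ('s \<Rightarrow> 'a \<Rightarrow> real) \<Rightarrow> ('s \<Rightarrow> 'a \<Rightarrow> real)
    \<Rightarrow> 's pmf \<Rightarrow> real \<Rightarrow> ('s, 'a) policy \<Rightarrow> real \<Rightarrow> real"
where
  "lagrangian \<gamma> U r c \<rho> b \<pi> l =
     robust_value_init \<gamma> U r \<pi> \<rho> + l * (robust_value_init \<gamma> U c \<pi> \<rho> - b)"

text \<open>
  As for the robust value, the inner maximum is rendered as a supremum in the objective of the
  outer minimisation; at the optimal multiplier it is required to be attained.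
\<close>

definition optimal_solution ::
  "real \<Rightarrow> ('s::finite \<Rightarrow> 'a::finite \<Rightarrow> 's pmf set) \<Rightarrow> ('s \<Rightarrow> 'a \<Rightarrow> real) \<Rightarrow> ('s \<Rightarrow> 'a \<Rightarrow> real)
    \<Rightarrow> 's pmf \<Rightarrow> real \<Rightarrow> 'p set \<Rightarrow> ('p \<Rightarrow> ('s, 'a) policy) \<Rightarrow> real \<Rightarrow> 'p \<Rightarrow> bool"
where
  "optimal_solution \<gamma> U r c \<rho> b \<Theta> \<pi> l \<theta> \<longleftrightarrow>
     is_arg_min (\<lambda>l. SUP \<theta>\<in>\<Theta>. lagrangian \<gamma> U r c \<rho> b (\<pi> \<theta>) l) (\<lambda>l. 0 \<le> l) l \<and>
     is_arg_max (\<lambda>\<theta>. lagrangian \<gamma> U r c \<rho> b (\<pi> \<theta>) l) (\<lambda>\<theta>. \<theta> \<in> \<Theta>) \<theta>"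

end

theory Submission
  imports Defs
begin

text \<open>
  All robust values lie in \<open>[0, 1 / (1 - \<gamma>)]\<close>. Hence the dual function is at most
  \<open>1 / (1 - \<gamma>)\<close> at \<open>0\<close>, whereas the Slater policy forces it to be at least
  \<open>\<lambda> \<zeta>\<close> at \<open>\<lambda>\<close>; comparing the minimiser with \<open>0\<close> bounds it even by
  \<open>1 / (\<zeta> (1 - \<gamma>))\<close>.
\<close>

text \<open>Each term lies between 0 and \<open>\<gamma> ^ t\<close>, so comparison with the
  geometric series gives both summability and the bound.\<close>

lemma discounted_return_bounds:
  assumes "0 \<le> \<gamma>" "\<gamma> < 1" and h: "\<And>s a. h s a \<in> {0..1}"
  shows "discounted_return \<gamma> h \<omega> \<in> {0..1 / (1 - \<gamma>)}"
proof -
  let ?f = "\<lambda>t. \<gamma> ^ t * h (fst (\<omega> t)) (snd (\<omega> t))"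
  have f: "0 \<le> ?f t" "?f t \<le> \<gamma> ^ t" for t
    using h[of "fst (\<omega> t)" "snd (\<omega> t)"] assms(1) by (auto intro: mult_left_le)
  have geo: "summable (\<lambda>t. \<gamma> ^ t)"
    using assms by (simp add: summable_geometric)
  have summ: "summable ?f"
    by (rule summable_comparison_test'[OF geo, of 0]) (use f in simp)
  have "(\<Sum>t. ?f t) \<le> (\<Sum>t. \<gamma> ^ t)"
    using f(2) summ geo by (rule suminf_le)
  also have "\<dots> = 1 / (1 - \<gamma>)"
    using assms by (simp add: suminf_geometric)
  finally show ?thesis
    using suminf_nonneg[OF summ f(1)] by (simp add: discounted_return_def)
qed

text \<open>A non-integrable \<open>f\<close> has integral 0 by convention, and 0 lies in the
  interval because \<open>0 \<le> f undefined \<le> B\<close>. This lets the bound apply to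
  \<open>discounted_return\<close> without a measurability argument.\<close>

lemma (in prob_space) integral_bounds:
  fixes f :: "'a \<Rightarrow> real"
  assumes f: "\<And>x. f x \<in> {0..B}"
  shows "integral\<^sup>L M f \<in> {0..B}"
proof (cases "integrable M f")
  case True
  then show ?thesis
    using f by (auto intro!: integral_le_const integral_nonneg_AE)
next
  case False
  then show ?thesis
    using f[of undefined] by (auto simp: not_integrable_integral_eq)
qed

lemma robust_value_bounds:
  assumes "0 \<le> \<gamma>" "\<gamma> < 1" and "\<And>s a. h s a \<in> {0..1}" and U: "\<And>s a. U s a \<noteq> {}"
  shows "robust_value \<gamma> U h \<pi> s \<in> {0..1 / (1 - \<gamma>)}"
proof -
  let ?K = "{\<kappa> :: nat \<Rightarrow> _. \<forall>t. \<kappa> t \<in> rectangular U}"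
  let ?J = "\<lambda>\<kappa>. integral\<^sup>L (trajectory \<kappa> \<pi> s) (discounted_return \<gamma> h)"
  have J: "?J \<kappa> \<in> {0..1 / (1 - \<gamma>)}" for \<kappa>
    using discounted_return_bounds[of \<gamma> h] assms
    by (intro prob_space.integral_bounds prob_space_trajectory) auto
  \<comment> \<open>A time-independent kernel chosen separately at each pair \<open>s\<close>,
    \<open>a\<close>; rectangularity makes any such choice admissible. It shows that the infimum
    ranges over a nonempty set.\<close>
  have K: "(\<lambda>_ s a. SOME u. u \<in> U s a) \<in> ?K"
    using U by (auto simp: rectangular_def some_in_eq)
  have "bdd_below (?J ` ?K)"
    using J by (intro bdd_belowI2[where m = 0]) auto
  then have "(INF \<kappa>\<in>?K. ?J \<kappa>) \<le> 1 / (1 - \<gamma>)"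
    using K J by (intro cINF_lower2[OF _ K]) auto
  moreover have "0 \<le> (INF \<kappa>\<in>?K. ?J \<kappa>)"
    using K J by (intro cINF_greatest) auto
  ultimately show ?thesis by (simp add: robust_value_def)
qed

text \<open>The initial value is a convex combination of the statewise robust values, with weights
  \<open>pmf \<rho> s\<close>.\<close>

lemma robust_value_init_bounds:
  assumes "0 \<le> \<gamma>" "\<gamma> < 1" and "\<And>s a. h s a \<in> {0..1}" and "\<And>s a. U s a \<noteq> {}"
  shows "robust_value_init \<gamma> U h \<pi> \<rho> \<in> {0..1 / (1 - \<gamma>)}"
proof -
  have V: "0 \<le> robust_value \<gamma> U h \<pi> s" "robust_value \<gamma> U h \<pi> s \<le> 1 / (1 - \<gamma>)" for s
    using robust_value_bounds[of \<gamma> h U \<pi> s] assms by auto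
  have "robust_value_init \<gamma> U h \<pi> \<rho> \<le> (\<Sum>s\<in>UNIV. pmf \<rho> s * (1 / (1 - \<gamma>)))"
    unfolding robust_value_init_def by (intro sum_mono mult_left_mono V) simp
  also have "\<dots> = (\<Sum>s\<in>UNIV. pmf \<rho> s) * (1 / (1 - \<gamma>))"
    by (rule sum_distrib_right[symmetric])
  also have "(\<Sum>s\<in>UNIV. pmf \<rho> s) = 1"
    by (rule sum_pmf_eq_1) auto
  finally show ?thesis
    using V(1) by (auto simp: robust_value_init_def intro!: sum_nonneg)
qed

theorem lemma2:
  fixes \<gamma> b \<zeta> lopt :: real
    and r c :: "'s::finite \<Rightarrow> 'a::finite \<Rightarrow> real"
    and \<rho> :: "'s pmf"
    and U :: "'s \<Rightarrow> 'a \<Rightarrow> 's pmf set"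
    and \<Theta> :: "(real ^ 'd) set"
    and \<pi> :: "real ^ 'd \<Rightarrow> ('s, 'a) policy"
    and \<theta>opt :: "real ^ 'd"
  assumes "0 \<le> \<gamma>" "\<gamma> < 1"
    and "\<And>s a. r s a \<in> {0..1}"
    and "\<And>s a. c s a \<in> {0..1}"
    and "b > 0"
    and "\<And>s a. U s a \<noteq> {}"
    and "\<zeta> > 0"
    and "\<exists>p\<in>\<pi> ` \<Theta>. robust_value_init \<gamma> U c p \<rho> - b \<ge> \<zeta>"
    and "optimal_solution \<gamma> U r c \<rho> b \<Theta> \<pi> lopt \<theta>opt"
  shows "lopt \<in> {0..2 / (\<zeta> * (1 - \<gamma>))}"
proof -
  let ?L = "\<lambda>\<theta>. lagrangian \<gamma> U r c \<rho> b (\<pi> \<theta>)"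
  let ?D = "\<lambda>l. SUP \<theta>\<in>\<Theta>. ?L \<theta> l"
  have lopt: "0 \<le> lopt" "?D lopt \<le> ?D 0"
    and max: "\<And>\<theta>. \<theta> \<in> \<Theta> \<Longrightarrow> ?L \<theta> lopt \<le> ?L \<theta>opt lopt"
    using assms(9) by (auto simp: optimal_solution_def is_arg_min_linorder is_arg_max_linorder)
  obtain \<theta> where \<theta>: "\<theta> \<in> \<Theta>" "\<zeta> \<le> robust_value_init \<gamma> U c (\<pi> \<theta>) \<rho> - b"
    using assms(8) by auto
  have V: "robust_value_init \<gamma> U r p \<rho> \<in> {0..1 / (1 - \<gamma>)}" for p
    using assms by (intro robust_value_init_bounds) auto
  have "lopt * \<zeta> \<le> ?L \<theta> lopt"
    using mult_left_mono[OF \<theta>(2) lopt(1)] V[of "\<pi> \<theta>"] by (simp add: lagrangian_def)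
  \<comment> \<open>A real supremum dominates its members only if the family is bounded above; the
    maximum attained at \<open>\<theta>opt\<close> supplies the bound.\<close>
  also have "\<dots> \<le> ?D lopt"
    using \<theta>(1) max by (intro cSUP_upper bdd_aboveI2) auto
  also note lopt(2)
  \<comment> \<open>At multiplier 0 the constraint term vanishes and only reward values remain; the
    Slater parameter \<open>\<theta>\<close> makes \<open>\<Theta>\<close> nonempty.\<close>
  also have "?D 0 \<le> 1 / (1 - \<gamma>)"
    using \<theta>(1) V by (intro cSUP_least) (auto simp: lagrangian_def)
  finally have "lopt \<le> 1 / (\<zeta> * (1 - \<gamma>))"
    using assms(2,7) by (simp add: field_simps)
  also have "\<dots> \<le> 2 / (\<zeta> * (1 - \<gamma>))"
    using assms(2,7) by (intro divide_right_mono) auto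
  finally show ?thesis using lopt(1) by simp
qed

end
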